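(* Let $D$ be an integral domain, let $\star$ be a semistar operation on $D$, and let $R=D^{\widetilde\star}$. Assume that $D$ is a P$\star$MD. Then $R$ is a P$v_R$MD, $$\mathrm{QSpec}^{\star_f}(D)=\{Q\cap D\mid Q\in\mathrm{Spec}^{t_R}(R)\},$$ and $R_Q=D_{Q\cap D}$ for each $Q\in\mathrm{Spec}^{t_R}(R)$.
   Context: Let $D$ be an integral domain with quotient field $K$. Denote by $\overline{\boldsymbol F}(D)$ the set of nonzero $D$-submodules of $K$ and by $\boldsymbol f(D)$ the set of nonzero finitely generated $D$-submodules of $K$. A semistar operation on $D$ is a map $\star:\overline{\boldsymbol F}(D)\to\overline{\boldsymbol F}(D)$, $E\mapsto E^\star$, such that for all $0\ne x\in K$ and $E,F\in\overline{\boldsymbol F}(D)$: $(xE)^\star=xE^\star$; $E\subseteq F$ implies $E^\star\subseteq F^\star$; $E\subseteq E^\star$ and $(E^\star)^\star=E^\star$. The associated finite-type operation is $E^{\star_f}:=\bigcup\{F^\star\mid F\in\boldsymbol f(D),\,F\subseteq E\}$. P$\star$MD: $D$ is a P$\star$MD if $(FF^{-1})^{\star_f}=D^{\star}$ for every $F\in\boldsymbol f(D)$, where $F^{-1}=(D:_KF)$. A nonzero ideal $I$ of $D$ is a quasi-$\star$-ideal if $I^\star\cap D=I$. $\mathrm{QSpec}^{\star}(D)$ is the set of prime quasi-$\star$-ideals, and $\mathrm{QMax}^{\star}(D)$ the set of ideals maximal among the proper quasi-$\star$-ideals. The operation $\widetilde\star$ is $E^{\widetilde\star}:=\bigcap\{ED_Q\mid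 Q\in\mathrm{QMax}^{\star_f}(D)\}$ (equal to $K$ if $\mathrm{QMax}^{\star_f}(D)=\emptyset$). For a domain $R$, $v_R$ is the operation $E^{v_R}=(R:(R:E))$ (colons in the quotient field of $R$), $t_R:=(v_R)_f$, and $\mathrm{Spec}^{t_R}(R)$ is the set of nonzero prime ideals $Q$ of $R$ with $Q^{t_R}=Q$. $R$ is a P$v_R$MD if $(FF^{-1})^{t_R}=R$ for every nonzero finitely generated fractional ideal $F$ of $R$. *)

theory Defs
  imports
    "HOL-Algebra.Algebra"
    "HOL-Algebra.Algebraic_Closure_Type"
    "HOL-Computational_Algebra.Group_Closure"
begin

text \<open>
  An integral domain \<open>D\<close> is a subset of its quotient field \<open>K\<close>, where \<open>K\<close> is the whole type
  \<open>'k::field\<close>.  Since the type is arbitrary this covers every domain (embed it into its field of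
  fractions), and it lets overrings of \<open>D\<close> in \<open>K\<close> be treated by the same definitions.
  \<open>ring_of_type_algebra\<close> is the library's view of the type \<open>'k\<close> as a HOL-Algebra ring.
\<close>

definition as_ring :: "'k::field set \<Rightarrow> 'k ring" where
  "as_ring D = ring_of_type_algebra\<lparr>carrier := D\<rparr>"

definition field_module :: "('k::field, 'k) module" where
  "field_module =
     \<lparr>carrier = UNIV, monoid.mult = (*), one = 1, ring.zero = 0, add = (+), module.smult = (*)\<rparr>"

definition domain_with_quotient_field :: "'k::field set \<Rightarrow> bool" where
  "domain_with_quotient_field D \<longleftrightarrow>
     subdomain D ring_of_type_algebra \<and> (\<forall>x. \<exists>a\<in>D. \<exists>b\<in>D - {0}. x = a / b)"

definition Fbar :: "'k::field set \<Rightarrow> 'k set set" where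
  "Fbar D = {E. submodule E (as_ring D) field_module \<and> E \<noteq> {0}}"

definition fg :: "'k::field set \<Rightarrow> 'k set set" where
  "fg D = {E \<in> Fbar D. \<exists>G. finite G \<and> E = {\<Sum>x\<in>G. c x * x |c. \<forall>x\<in>G. c x \<in> D}}"

definition fractional_ideals :: "'k::field set \<Rightarrow> 'k set set" where
  "fractional_ideals D = {E \<in> Fbar D. \<exists>d\<in>D - {0}. \<forall>x\<in>E. d * x \<in> D}"

definition colon :: "'k::field set \<Rightarrow> 'k set \<Rightarrow> 'k set" where
  "colon A B = {x. \<forall>b\<in>B. x * b \<in> A}"

definition module_prod :: "'k::field set \<Rightarrow> 'k set \<Rightarrow> 'k set" where
  "module_prod E F = group_closure {x * y |x y. x \<in> E \<and> y \<in> F}"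

definition localization :: "'k::field set \<Rightarrow> 'k set \<Rightarrow> 'k set" where
  "localization D Q = {a / s |a s. a \<in> D \<and> s \<in> D - Q}"

text \<open>
  Operations on \<open>Fbar D\<close> are total functions on sets; their values outside \<open>Fbar D\<close> are irrelevant.
\<close>

definition semistar :: "'k::field set \<Rightarrow> ('k set \<Rightarrow> 'k set) \<Rightarrow> bool" where
  "semistar D star \<longleftrightarrow>
     star \<in> Fbar D \<rightarrow> Fbar D \<and>
     (\<forall>x. \<forall>E\<in>Fbar D. x \<noteq> 0 \<longrightarrow> star ((*) x ` E) = (*) x ` star E) \<and>
     (\<forall>E\<in>Fbar D. \<forall>F\<in>Fbar D. E \<subseteq> F \<longrightarrow> star E \<subseteq> star F) \<and>
     (\<forall>E\<in>Fbar D. E \<subseteq> star E \<and> star (star E) = star E)"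

definition finite_type :: "'k::field set \<Rightarrow> ('k set \<Rightarrow> 'k set) \<Rightarrow> 'k set \<Rightarrow> 'k set" where
  "finite_type D star E = \<Union>{star F |F. F \<in> fg D \<and> F \<subseteq> E}"

definition PstarMD :: "'k::field set \<Rightarrow> ('k set \<Rightarrow> 'k set) \<Rightarrow> bool" where
  "PstarMD D star \<longleftrightarrow>
     (\<forall>F\<in>fg D. finite_type D star (module_prod F (colon D F)) = star D)"

definition quasi_ideal :: "'k::field set \<Rightarrow> ('k set \<Rightarrow> 'k set) \<Rightarrow> 'k set \<Rightarrow> bool" where
  "quasi_ideal D star I \<longleftrightarrow> ideal I (as_ring D) \<and> I \<noteq> {0} \<and> star I \<inter> D = I"

definition QSpec :: "'k::field set \<Rightarrow> ('k set \<Rightarrow> 'k set) \<Rightarrow> 'k set set" where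
  "QSpec D star = {P. primeideal P (as_ring D) \<and> quasi_ideal D star P}"

definition QMax :: "'k::field set \<Rightarrow> ('k set \<Rightarrow> 'k set) \<Rightarrow> 'k set set" where
  "QMax D star =
     {M. quasi_ideal D star M \<and> M \<noteq> D \<and>
         (\<forall>J. quasi_ideal D star J \<and> J \<noteq> D \<and> M \<subseteq> J \<longrightarrow> J = M)}"

text \<open>If there are no quasi-maximal ideals the intersection is \<open>UNIV\<close>, i.e. \<open>K\<close>.\<close>

definition tilde :: "'k::field set \<Rightarrow> ('k set \<Rightarrow> 'k set) \<Rightarrow> 'k set \<Rightarrow> 'k set" where
  "tilde D star E = (\<Inter>Q\<in>QMax D (finite_type D star). module_prod E (localization D Q))"

definition v_op :: "'k::field set \<Rightarrow> 'k set \<Rightarrow> 'k set" where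
  "v_op R E = colon R (colon R E)"

definition t_op :: "'k::field set \<Rightarrow> 'k set \<Rightarrow> 'k set" where
  "t_op R = finite_type R (v_op R)"

definition tSpec :: "'k::field set \<Rightarrow> 'k set set" where
  "tSpec R = {Q. primeideal Q (as_ring R) \<and> Q \<noteq> {0} \<and> t_op R Q = Q}"

text \<open>
  The first conjunct records that \<open>R\<close> is a domain whose quotient field is all of \<open>'k\<close>, so that
  \<open>colon\<close>, which ranges over \<open>'k\<close>, is taken in the quotient field of \<open>R\<close>.
\<close>

definition PvMD :: "'k::field set \<Rightarrow> bool" where
  "PvMD R \<longleftrightarrow>
     domain_with_quotient_field R \<and>
     (\<forall>F\<in>fractional_ideals R \<inter> fg R. t_op R (module_prod F (colon R F)) = R)"

end

theory Submission
  imports Defs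
begin

text \<open>
  Invertibility enters only as follows.  If \<open>F = D a\<^sub>1 + \<dots> + D a\<^sub>n\<close> and \<open>P\<close> is a quasi-prime for \<open>\<star>\<^sub>f\<close>,
  then \<open>F F\<^sup>-\<^sup>1 \<subseteq> P\<close> would put \<open>1\<close> into \<open>P\<^sup>\<star>\<^sup>f \<inter> D = P\<close>; so some generator \<open>a = a\<^sub>i\<close> and some
  \<open>y \<in> F\<^sup>-\<^sup>1\<close> satisfy \<open>a y \<in> D - P\<close>, and each \<open>z\<close> can be written \<open>(z y) a / (a y)\<close> with denominator a unit
  of \<open>D\<^sub>P\<close>.  This shows that \<open>P D\<^sub>P \<inter> R\<close> is a \<open>t\<close>-prime of \<open>R\<close> lying over \<open>P\<close>.  Conversely, for
  \<open>x \<in> F\<^sup>\<star> \<inter> D\<close>, applying this to \<open>F + D x\<close> at each quasi-maximal ideal gives \<open>x \<in> (F R)\<^sup>v\<close>, so that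
  \<open>t\<close>-primes of \<open>R\<close> contract to quasi-primes of \<open>D\<close>.  The localizations agree because
  \<open>R\<close> lies between \<open>D\<close> and \<open>D\<^sub>P\<close> for every quasi-prime \<open>P\<close>, as quasi-primes lie in quasi-maximal ideals.
  Finally, a finitely generated \<open>J \<subseteq> F F\<^sup>-\<^sup>1\<close> with \<open>1 \<in> J\<^sup>\<star>\<close> is contained in no quasi-maximal ideal,
  hence \<open>(R : J) = R\<close>, which makes \<open>F R\<close> \<open>t\<close>-invertible.
\<close>

section \<open>Modules and primes inside the quotient field\<close>

text \<open>The library's \<open>subring\<close>, \<open>ideal\<close> and \<open>submodule\<close>
  express negatives through \<open>m_inv\<close> of an additive group record; evaluating it opens
  the way to plain field arithmetic.\<close>

lemma m_inv_additive:
  assumes "monoid.mult G = (+)" "one G = 0" "-x \<in> carrier G"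
  shows "m_inv G x = - (x::'k::field)"
  unfolding m_inv_def
proof (rule the_equality)
  show "y = - x"
    if "y \<in> carrier G \<and> x \<otimes>\<^bsub>G\<^esub> y = \<one>\<^bsub>G\<^esub> \<and> y \<otimes>\<^bsub>G\<^esub> x = \<one>\<^bsub>G\<^esub>" for y
    using that assms(1,2) by (simp add: eq_neg_iff_add_eq_0)
qed (use assms in simp)

text \<open>Negatives arise by scaling with -1 once \<open>D\<close> is a ring, see
  \<open>module_uminus\<close>.\<close>

definition is_module :: "'k::field set \<Rightarrow> 'k set \<Rightarrow> bool" where
  "is_module D E \<longleftrightarrow> 0 \<in> E \<and> (\<forall>x\<in>E. \<forall>y\<in>E. x + y \<in> E) \<and> (\<forall>d\<in>D. \<forall>x\<in>E. d * x \<in> E)"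

definition lin_span :: "'k::field set \<Rightarrow> 'k set \<Rightarrow> 'k set" where
  "lin_span D G = {\<Sum>x\<in>G. c x * x |c. \<forall>x\<in>G. c x \<in> D}"

lemma is_moduleD:
  assumes "is_module D E"
  shows "0 \<in> E" "x \<in> E \<Longrightarrow> y \<in> E \<Longrightarrow> x + y \<in> E" "d \<in> D \<Longrightarrow> x \<in> E \<Longrightarrow> d * x \<in> E"
  using assms by (auto simp: is_module_def)

lemma is_module_sum:
  assumes "is_module D E" "\<And>x. x \<in> G \<Longrightarrow> f x \<in> E"
  shows "sum f G \<in> E"
  using assms(2) by (induction G rule: infinite_finite_induct) (auto simp: is_moduleD[OF assms(1)])

lemma lin_span_least: "is_module D E \<Longrightarrow> G \<subseteq> E \<Longrightarrow> lin_span D G \<subseteq> E"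
  unfolding lin_span_def by clarify (rule is_module_sum, assumption, metis is_moduleD(3) subsetD)

lemma group_closure_least:
  assumes "S \<subseteq> T" "0 \<in> T" "\<And>x y. x \<in> T \<Longrightarrow> y \<in> T \<Longrightarrow> x - y \<in> T"
  shows "group_closure S \<subseteq> T"
proof
  show "x \<in> T" if "x \<in> group_closure S" for x
    using that
  proof induction
    case (base s)
    with assms(1,2) show ?case by blast
  qed (rule assms(3))
qed

lemma module_prodI: "x \<in> E \<Longrightarrow> y \<in> F \<Longrightarrow> x * y \<in> module_prod E F"
  unfolding module_prod_def by (rule group_closure.base) auto

text \<open>A locale, because it is used twice inside the same field: for \<open>D\<close> and,
  under the prefix \<open>over\<close>, for the overring.\<close>

locale field_domain =
  fixes D :: "'k::field set"
  assumes zero_mem [simp]: "0 \<in> D" and one_mem [simp]: "1 \<in> D"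
    and uminus_mem: "x \<in> D \<Longrightarrow> - x \<in> D"
    and add_mem: "x \<in> D \<Longrightarrow> y \<in> D \<Longrightarrow> x + y \<in> D"
    and mult_mem: "x \<in> D \<Longrightarrow> y \<in> D \<Longrightarrow> x * y \<in> D"
    and is_fraction: "\<exists>a\<in>D. \<exists>b\<in>D - {0}. x = a / b"

text \<open>The absence of zero divisors is inherited from the field (\<open>subdomainI'\<close>),
  so the locale lists only closure properties and the representation by fractions.\<close>

lemma domain_with_quotient_field_iff: "domain_with_quotient_field D \<longleftrightarrow> field_domain D"
proof
  assume *: "domain_with_quotient_field D"
  then interpret subdomain D "ring_of_type_algebra"
    by (simp add: domain_with_quotient_field_def)
  have "- x \<in> D" if "x \<in> D" for x
    using m_inv_closed that by (simp add: m_inv_additive ring_of_type_algebra_def)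
  then show "field_domain D"
    using * subgroup_axioms submonoid_axioms
    by (auto simp: field_domain_def domain_with_quotient_field_def ring_of_type_algebra_def
        subgroup_def submonoid_def)
next
  assume "field_domain D"
  then interpret field_domain D .
  interpret field "ring_of_type_algebra :: 'a ring" by (rule field_from_type_algebra)
  have "subring D (ring_of_type_algebra :: 'a ring)"
    by (intro subring.intro subgroup.intro submonoid.intro)
       (auto simp: ring_of_type_algebra_def m_inv_additive add_mem mult_mem uminus_mem)
  then have "subdomain D (ring_of_type_algebra :: 'a ring)"
    by (rule subdomainI')
  then show "domain_with_quotient_field D"
    using is_fraction by (auto simp: domain_with_quotient_field_def)
qed

context field_domain
begin

lemma module_uminus: "is_module D E \<Longrightarrow> x \<in> E \<Longrightarrow> - x \<in> E"
  using is_moduleD(3)[of D E "-1" x] uminus_mem[of 1] by simp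

lemma module_diff: "is_module D E \<Longrightarrow> x \<in> E \<Longrightarrow> y \<in> E \<Longrightarrow> x - y \<in> E"
  using is_moduleD(2)[of D E x "- y"] module_uminus[of E y] by simp

lemma self_module: "is_module D D"
  by (simp add: is_module_def add_mem mult_mem)

lemma Fbar_iff: "E \<in> Fbar D \<longleftrightarrow> is_module D E \<and> E \<noteq> {0}"
proof -
  have "submodule E (as_ring D) field_module \<longleftrightarrow> is_module D E"
  proof
    assume "submodule E (as_ring D) field_module"
    then interpret submodule E "as_ring D" field_module .
    show "is_module D E"
      unfolding is_module_def
      using one_closed m_closed smult_closed by (simp add: field_module_def as_ring_def)
  next
    assume *: "is_module D E"
    show "submodule E (as_ring D) field_module"
      by (intro submodule.intro subgroup.intro submodule_axioms.intro)
         (simp_all add: is_moduleD[OF *] module_uminus[OF *] m_inv_additive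
            field_module_def as_ring_def)
  qed
  then show ?thesis
    by (simp add: Fbar_def)
qed

lemma cring_as_ring: "cring (as_ring D)"
proof -
  have "\<exists>y\<in>D. x + y = 0" if "x \<in> D" for x
    using uminus_mem that by (intro bexI[of _ "- x"]) auto
  then show ?thesis
    unfolding as_ring_def ring_of_type_algebra_def
    by unfold_locales (auto simp: algebra_simps Units_def add_mem mult_mem)
qed

lemma ideal_iff: "ideal I (as_ring D) \<longleftrightarrow> is_module D I \<and> I \<subseteq> D"
proof
  assume "ideal I (as_ring D)"
  then interpret ideal I "as_ring D" .
  show "is_module D I \<and> I \<subseteq> D"
    unfolding is_module_def
    using a_subset subgroup.one_closed[OF a_subgroup] subgroup.m_closed[OF a_subgroup] I_l_closed
    by (simp add: as_ring_def ring_of_type_algebra_def)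
next
  assume "is_module D I \<and> I \<subseteq> D"
  then have *: "is_module D I" and sub: "I \<subseteq> D" by simp_all
  have right: "a * x \<in> I" if "a \<in> I" "x \<in> D" for a x
    using is_moduleD(3)[OF *] that by (metis mult.commute)
  interpret cring "as_ring D" by (rule cring_as_ring)
  show "ideal I (as_ring D)"
    by (intro idealI subgroup.intro ring_axioms)
       (use sub uminus_mem in \<open>auto simp: is_moduleD[OF *] module_uminus[OF *] right
          m_inv_additive as_ring_def ring_of_type_algebra_def\<close>)
qed

text \<open>Properness is put as \<open>1 \<notin> P\<close>, the form in which it is used. The zero
  ideal is allowed; \<open>QSpec\<close> and \<open>tSpec\<close> exclude it themselves.\<close>

definition is_prime :: "'k set \<Rightarrow> bool" where
  "is_prime P \<longleftrightarrow> is_module D P \<and> P \<subseteq> D \<and> 1 \<notin> P \<and>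
     (\<forall>a\<in>D. \<forall>b\<in>D. a * b \<in> P \<longrightarrow> a \<in> P \<or> b \<in> P)"

lemma eq_carrier_iff: "is_module D I \<Longrightarrow> I \<subseteq> D \<Longrightarrow> I = D \<longleftrightarrow> 1 \<in> I"
  using is_moduleD(3)[of D I _ 1] by auto

lemma primeideal_iff: "primeideal P (as_ring D) \<longleftrightarrow> is_prime P"
proof -
  have "primeideal P (as_ring D) \<longleftrightarrow> ideal P (as_ring D) \<and> D \<noteq> P \<and>
      (\<forall>a\<in>D. \<forall>b\<in>D. a * b \<in> P \<longrightarrow> a \<in> P \<or> b \<in> P)"
    using cring_as_ring
    by (auto simp: primeideal_def primeideal_axioms_def as_ring_def ring_of_type_algebra_def)
  then show ?thesis
    using eq_carrier_iff[of P] by (auto simp: is_prime_def ideal_iff)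
qed

section \<open>Finitely generated modules and products of modules\<close>

lemma lin_span_module: "is_module D (lin_span D G)"
proof -
  have "0 \<in> lin_span D G"
    unfolding lin_span_def by (rule CollectI, rule exI[of _ "\<lambda>_. 0"]) simp
  moreover have "x + y \<in> lin_span D G" if "x \<in> lin_span D G" "y \<in> lin_span D G" for x y
  proof -
    from that obtain c d where cd: "x = (\<Sum>x\<in>G. c x * x)" "\<forall>x\<in>G. c x \<in> D"
        "y = (\<Sum>x\<in>G. d x * x)" "\<forall>x\<in>G. d x \<in> D"
      unfolding lin_span_def by blast
    then show ?thesis
      unfolding lin_span_def
      by (intro CollectI exI[of _ "\<lambda>x. c x + d x"]) (auto simp: add_mem sum.distrib algebra_simps)
  qed
  moreover have "d * x \<in> lin_span D G" if "d \<in> D" "x \<in> lin_span D G" for d x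
  proof -
    from that obtain c where c: "x = (\<Sum>x\<in>G. c x * x)" "\<forall>x\<in>G. c x \<in> D"
      unfolding lin_span_def by blast
    then show ?thesis
      using that unfolding lin_span_def
      by (intro CollectI exI[of _ "\<lambda>x. d * c x"]) (auto simp: mult_mem sum_distrib_left mult.assoc)
  qed
  ultimately show ?thesis
    by (simp add: is_module_def)
qed

text \<open>Kronecker delta coefficients pick out a single generator. Finiteness matters because
  \<open>sum\<close> over an infinite set is 0.\<close>

lemma lin_span_superset:
  assumes "finite G"
  shows "G \<subseteq> lin_span D G"
proof
  fix a assume "a \<in> G"
  then have "a = (\<Sum>x\<in>G. (if x = a then 1 else 0) * x)"
    using assms by (simp add: if_distrib[of "\<lambda>t. t * _"] cong: if_cong)
  then show "a \<in> lin_span D G"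
    unfolding lin_span_def
    by (intro CollectI exI[of _ "\<lambda>x. if x = a then 1 else 0"]) auto
qed

lemma fgE:
  assumes "F \<in> fg D"
  obtains G where "finite G" "F = lin_span D G" "F \<noteq> {0}"
  using assms by (auto simp: fg_def lin_span_def Fbar_iff)

lemma fgI:
  assumes "finite G" "x \<in> G" "x \<noteq> 0"
  shows "lin_span D G \<in> fg D"
proof -
  have "lin_span D G \<noteq> {0}"
    using lin_span_superset[OF assms(1)] assms by blast
  then show ?thesis
    using assms lin_span_module by (auto simp: fg_def lin_span_def Fbar_iff)
qed

lemma fg_Fbar: "F \<in> fg D \<Longrightarrow> F \<in> Fbar D"
  by (simp add: fg_def)

lemma fg_generator:
  assumes "F \<in> fg D"
  obtains G x where "finite G" "F = lin_span D G" "x \<in> G" "x \<noteq> 0"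
proof -
  obtain G where G: "finite G" "F = lin_span D G" "F \<noteq> {0}"
    using assms by (rule fgE)
  have "\<not> G \<subseteq> {0}"
    using lin_span_least[of D "{0}" G] G(2,3) is_moduleD(1)[OF lin_span_module[of G]]
    by (auto simp: is_module_def)
  with that G show thesis by auto
qed

text \<open>The union of the generating sets spans the sum of the two modules, given here by its
  universal property. Hence the finitely generated submodules of a fixed module are
  directed.\<close>

lemma fg_join:
  assumes "F1 \<in> fg D" "F2 \<in> fg D"
  obtains F where "F \<in> fg D" "F1 \<subseteq> F" "F2 \<subseteq> F"
    "\<And>E. is_module D E \<Longrightarrow> F1 \<subseteq> E \<Longrightarrow> F2 \<subseteq> E \<Longrightarrow> F \<subseteq> E"
proof -
  obtain G1 x where G1: "finite G1" "F1 = lin_span D G1" "x \<in> G1" "x \<noteq> 0"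
    using assms(1) by (rule fg_generator)
  obtain G2 where G2: "finite G2" "F2 = lin_span D G2"
    using assms(2) by (rule fgE)
  have sup: "G1 \<union> G2 \<subseteq> lin_span D (G1 \<union> G2)"
    using G1(1) G2(1) by (intro lin_span_superset) simp
  show thesis
  proof (rule that[of "lin_span D (G1 \<union> G2)"])
    show "lin_span D (G1 \<union> G2) \<in> fg D"
      using G1 G2 by (intro fgI[of _ x]) auto
    show "F1 \<subseteq> lin_span D (G1 \<union> G2)" "F2 \<subseteq> lin_span D (G1 \<union> G2)"
      using sup G1 G2 by (simp_all add: lin_span_least lin_span_module)
    show "lin_span D (G1 \<union> G2) \<subseteq> E" if "is_module D E" "F1 \<subseteq> E" "F2 \<subseteq> E" for E
      using that lin_span_superset[OF G1(1)] lin_span_superset[OF G2(1)] G1 G2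
      by (intro lin_span_least) auto
  qed
qed

lemma module_prod_least:
  assumes "is_module D T" "\<And>x y. x \<in> E \<Longrightarrow> y \<in> F \<Longrightarrow> x * y \<in> T"
  shows "module_prod E F \<subseteq> T"
  unfolding module_prod_def
  by (rule group_closure_least) (use assms in \<open>auto simp: is_moduleD(1) module_diff\<close>)

lemma module_prod_module:
  assumes "is_module D E"
  shows "is_module D (module_prod E F)"
proof -
  have "d * x \<in> module_prod E F" if "d \<in> D" "x \<in> module_prod E F" for d x
    using that(2) unfolding module_prod_def
  proof induction
    case (base s)
    then consider "s = 0" | x y where "s = x * y" "x \<in> E" "y \<in> F" by auto
    then show ?case
    proof cases
      case 2
      then show ?thesis
        using module_prodI[of "d * x" E y F] is_moduleD(3)[OF assms that(1)]
        by (simp add: module_prod_def mult.assoc)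
    qed simp
  next
    case (diff s t)
    then show ?case
      by (simp add: right_diff_distrib group_closure.diff)
  qed
  then show ?thesis
    by (simp add: is_module_def module_prod_def group_closure_add)
qed

lemma nonzero_mult_mem: "\<exists>b\<in>D - {0}. b * x \<in> D"
proof -
  obtain a b where "a \<in> D" "b \<in> D - {0}" "x = a / b"
    using is_fraction by blast
  then show ?thesis by (intro bexI[of _ b]) auto
qed

lemma module_prod_colon_subset: "module_prod F (colon D F) \<subseteq> D"
  by (rule module_prod_least[OF self_module]) (auto simp: colon_def mult.commute)

section \<open>Localization at a prime and the extended prime\<close>

lemma localization_iff: "x \<in> localization D P \<longleftrightarrow> (\<exists>a\<in>D. \<exists>s\<in>D - P. x = a / s)"
  by (auto simp: localization_def)

lemma is_primeD:
  assumes "is_prime P"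
  shows "is_module D P" "P \<subseteq> D" "1 \<notin> P" "0 \<in> P"
    "a \<in> D \<Longrightarrow> b \<in> D \<Longrightarrow> a * b \<in> P \<Longrightarrow> a \<in> P \<or> b \<in> P"
  using assms by (auto simp: is_prime_def is_module_def)

lemma localization_mono: "P \<subseteq> Q \<Longrightarrow> localization D Q \<subseteq> localization D P"
  by (auto simp: localization_def)

lemma localization_superset: "is_prime P \<Longrightarrow> D \<subseteq> localization D P"
  by (force simp: localization_iff is_primeD intro: bexI[of _ 1])

lemma localization_mult:
  assumes P: "is_prime P" and "x \<in> localization D P" "y \<in> localization D P"
  shows "x * y \<in> localization D P"
proof -
  obtain a s b t where *: "a \<in> D" "s \<in> D - P" "x = a / s" "b \<in> D" "t \<in> D - P" "y = b / t"
    using assms(2,3) unfolding localization_iff by blast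
  then have "s * t \<in> D - P"
    using is_primeD(5)[OF P] mult_mem by blast
  with * show ?thesis
    unfolding localization_iff by (intro bexI[of _ "a * b"] bexI[of _ "s * t"]) (auto simp: mult_mem)
qed

lemma localization_add:
  assumes P: "is_prime P" and "x \<in> localization D P" "y \<in> localization D P"
  shows "x + y \<in> localization D P"
proof -
  obtain a s b t where *: "a \<in> D" "s \<in> D - P" "x = a / s" "b \<in> D" "t \<in> D - P" "y = b / t"
    using assms(2,3) unfolding localization_iff by blast
  then have "s * t \<in> D - P"
    using is_primeD(5)[OF P] mult_mem by blast
  moreover have "x + y = (a * t + b * s) / (s * t)"
    using * is_primeD(4)[OF P] by (subst *, subst *, subst add_frac_eq) (auto simp: mult_ac)
  ultimately show ?thesis
    using * unfolding localization_iff
    by (intro bexI[of _ "a * t + b * s"] bexI[of _ "s * t"]) (auto simp: mult_mem add_mem)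
qed

lemma localization_divide:
  assumes P: "is_prime P" and "x \<in> localization D P" "s \<in> D - P"
  shows "x / s \<in> localization D P"
proof -
  have "1 / s \<in> localization D P"
    using assms by (auto simp: localization_iff)
  from localization_mult[OF P assms(2) this] show ?thesis by simp
qed

lemma localization_module: "is_prime P \<Longrightarrow> is_module D (localization D P)"
  unfolding is_module_def
  using localization_superset[of P] localization_mult[of P] localization_add[of P]
  by (meson subsetD zero_mem)

text \<open>Turns \<open>tilde D star D\<close> into a plain intersection of localizations.\<close>

lemma module_prod_localization:
  assumes P: "is_prime P"
  shows "module_prod D (localization D P) = localization D P"
proof
  show "module_prod D (localization D P) \<subseteq> localization D P"
    by (rule module_prod_least) (use localization_module[OF P] is_moduleD(3) in auto)
  show "localization D P \<subseteq> module_prod D (localization D P)"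
    using module_prodI[of 1 D _ "localization D P"] by auto
qed

text \<open>\<open>P D\<^sub>P\<close>, in a form that avoids fractions.\<close>

definition prime_extension :: "'k set \<Rightarrow> 'k set" where
  "prime_extension P = {x. \<exists>s\<in>D - P. s * x \<in> P}"

lemma prime_compl_mult: "is_prime P \<Longrightarrow> s \<in> D - P \<Longrightarrow> t \<in> D - P \<Longrightarrow> s * t \<in> D - P"
  using is_primeD(5) mult_mem by blast

text \<open>Together with the next three lemmas: \<open>prime_extension P\<close> acts as a prime
  ideal of \<open>localization D P\<close> lying over \<open>P\<close>. The elementwise form lets it
  be cut down to any ring between \<open>D\<close> and that localization.\<close>

lemma prime_extension_Int:
  assumes P: "is_prime P"
  shows "prime_extension P \<inter> D = P"
proof
  show "prime_extension P \<inter> D \<subseteq> P"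
    using is_primeD(5)[OF P] by (auto simp: prime_extension_def)
  show "P \<subseteq> prime_extension P \<inter> D"
    using is_primeD(2,3)[OF P] by (auto simp: prime_extension_def intro!: bexI[of _ 1])
qed

lemma prime_extension_add:
  assumes P: "is_prime P" and "x \<in> prime_extension P" "y \<in> prime_extension P"
  shows "x + y \<in> prime_extension P"
proof -
  obtain s t where st: "s \<in> D - P" "s * x \<in> P" "t \<in> D - P" "t * y \<in> P"
    using assms(2,3) by (auto simp: prime_extension_def)
  have "t * (s * x) + s * (t * y) \<in> P"
    using st is_moduleD(2,3)[OF is_primeD(1)[OF P]] by blast
  then have "(s * t) * (x + y) \<in> P"
    by (simp add: algebra_simps)
  then show ?thesis
    using prime_compl_mult[OF P st(1,3)] unfolding prime_extension_def by blast
qed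

lemma prime_extension_mult:
  assumes P: "is_prime P" and "x \<in> localization D P" "y \<in> prime_extension P"
  shows "x * y \<in> prime_extension P"
proof -
  obtain a s t where st: "a \<in> D" "s \<in> D - P" "x = a / s" "t \<in> D - P" "t * y \<in> P"
    using assms(2,3) by (auto simp: prime_extension_def localization_iff)
  have "a * (t * y) \<in> P"
    using st is_moduleD(3)[OF is_primeD(1)[OF P]] by blast
  moreover have "s \<noteq> 0"
    using st(2) is_primeD(4)[OF P] by auto
  ultimately have "(s * t) * (x * y) \<in> P"
    using st(3) by (simp add: mult_ac)
  then show ?thesis
    using prime_compl_mult[OF P st(2,4)] unfolding prime_extension_def by blast
qed

lemma prime_extension_prime:
  assumes P: "is_prime P" and "x \<in> localization D P" "y \<in> localization D P"
    and "x * y \<in> prime_extension P"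
  shows "x \<in> prime_extension P \<or> y \<in> prime_extension P"
proof -
  obtain a s b t u where *: "a \<in> D" "s \<in> D - P" "x = a / s" "b \<in> D" "t \<in> D - P" "y = b / t"
      "u \<in> D - P" "u * (x * y) \<in> P"
    using assms(2-4) unfolding localization_iff prime_extension_def by blast
  have nz: "s \<noteq> 0" "t \<noteq> 0"
    using *(2,5) is_primeD(4)[OF P] by auto
  have "(s * t) * (u * (x * y)) \<in> P"
    using * is_moduleD(3)[OF is_primeD(1)[OF P]] mult_mem by blast
  then have "u * (a * b) \<in> P"
    using *(3,6) nz by (simp add: mult_ac)
  then have "a \<in> P \<or> b \<in> P"
    using is_primeD(5)[OF P] mult_mem * by blast
  then have "s * x \<in> P \<or> t * y \<in> P"
    using * nz by simp
  then show ?thesis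
    using * unfolding prime_extension_def by blast
qed

section \<open>The v- and t-operations\<close>

lemma v_op_subset_carrier: "F \<subseteq> D \<Longrightarrow> v_op D F \<subseteq> D"
  \<comment> \<open>The test element is 1, which lies in \<open>colon D F\<close> because
    \<open>F \<subseteq> D\<close>.\<close>
  unfolding v_op_def colon_def by (rule subsetI, drule CollectD, drule bspec[of _ _ 1]) auto

lemma t_op_iff: "x \<in> t_op D E \<longleftrightarrow> (\<exists>F\<in>fg D. F \<subseteq> E \<and> x \<in> v_op D F)"
  by (auto simp: t_op_def finite_type_def)

lemma t_op_subset_carrier:
  assumes "E \<subseteq> D"
  shows "t_op D E \<subseteq> D"
proof
  fix x assume "x \<in> t_op D E"
  then obtain F where "F \<subseteq> E" "x \<in> v_op D F"
    by (auto simp: t_op_iff)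
  then show "x \<in> D"
    using assms v_op_subset_carrier[of F] by blast
qed

lemma t_op_superset:
  assumes "is_module D E" "E \<noteq> {0}"
  shows "E \<subseteq> t_op D E"
proof
  fix x assume x: "x \<in> E"
  obtain e where e: "e \<in> E" "e \<noteq> 0"
    using assms is_moduleD(1) by blast
  \<comment> \<open>The nonzero \<open>e\<close> keeps the span nonzero even for
    \<open>x = 0\<close>, as membership in \<open>fg\<close> demands.\<close>
  let ?F = "lin_span D {x, e}"
  have "?F \<in> fg D"
    using e by (intro fgI[of _ e]) auto
  moreover have "?F \<subseteq> E"
    using assms e x by (intro lin_span_least) auto
  moreover have "x \<in> v_op D ?F"
    using lin_span_superset[of "{x, e}"] by (auto simp: v_op_def colon_def mult.commute)
  ultimately show "x \<in> t_op D E"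
    unfolding t_op_iff by blast
qed

lemma tSpec_iff: "Q \<in> tSpec D \<longleftrightarrow> is_prime Q \<and> Q \<noteq> {0} \<and> t_op D Q \<subseteq> Q"
  using t_op_superset[of Q] by (auto simp: tSpec_def primeideal_iff is_prime_def)

text \<open>The elements that \<open>y\<close> multiplies into \<open>A\<close> form a module, so
  testing generators suffices.\<close>

lemma colon_lin_spanI:
  assumes "is_module D A" "\<And>g. g \<in> G \<Longrightarrow> y * g \<in> A"
  shows "y \<in> colon A (lin_span D G)"
proof -
  have "is_module D {x. y * x \<in> A}"
    using is_moduleD[OF assms(1)] by (auto simp: is_module_def distrib_left mult.left_commute)
  then have "lin_span D G \<subseteq> {x. y * x \<in> A}"
    using assms(2) by (intro lin_span_least) auto
  then show ?thesis
    by (auto simp: colon_def)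
qed

end

section \<open>Finite-type semistar operations\<close>

locale semistar_domain = field_domain D for D :: "'k::field set" +
  fixes star :: "'k set \<Rightarrow> 'k set"
  assumes semistar: "semistar D star"
begin

lemma star_Fbar: "E \<in> Fbar D \<Longrightarrow> star E \<in> Fbar D"
  using semistar by (auto simp: semistar_def)

lemma star_scale: "E \<in> Fbar D \<Longrightarrow> x \<noteq> 0 \<Longrightarrow> star ((*) x ` E) = (*) x ` star E"
  using semistar by (auto simp: semistar_def)

lemma star_mono: "E \<in> Fbar D \<Longrightarrow> F \<in> Fbar D \<Longrightarrow> E \<subseteq> F \<Longrightarrow> star E \<subseteq> star F"
  using semistar by (auto simp: semistar_def)

lemma star_superset: "E \<in> Fbar D \<Longrightarrow> E \<subseteq> star E"
  using semistar by (auto simp: semistar_def)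

lemma star_idem: "E \<in> Fbar D \<Longrightarrow> star (star E) = star E"
  using semistar by (auto simp: semistar_def)

abbreviation star_f :: "'k set \<Rightarrow> 'k set" where
  "star_f \<equiv> finite_type D star"

lemma star_f_iff: "x \<in> star_f E \<longleftrightarrow> (\<exists>F\<in>fg D. F \<subseteq> E \<and> x \<in> star F)"
  by (auto simp: finite_type_def)

lemma star_f_mono: "E \<subseteq> E' \<Longrightarrow> star_f E \<subseteq> star_f E'"
  by (auto simp: finite_type_def)

lemma star_module: "F \<in> fg D \<Longrightarrow> is_module D (star F)"
  using star_Fbar fg_Fbar Fbar_iff by blast

lemma Fbar_nonzero: "E \<in> Fbar D \<Longrightarrow> \<exists>e\<in>E. e \<noteq> 0"
  using is_moduleD(1) by (auto simp: Fbar_iff)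

lemma star_fg_mono: "F \<in> fg D \<Longrightarrow> F' \<in> fg D \<Longrightarrow> F \<subseteq> F' \<Longrightarrow> star F \<subseteq> star F'"
  by (intro star_mono fg_Fbar)

text \<open>By directedness (\<open>fg_join\<close>), finitely many witnesses merge into one.
  Additivity and idempotence of \<open>star_f\<close> both rest on this.\<close>

lemma star_f_finite_cover:
  assumes E: "E \<in> Fbar D" and "finite G" "G \<subseteq> star_f E"
  shows "\<exists>F\<in>fg D. F \<subseteq> E \<and> G \<subseteq> star F"
  using assms(2,3)
proof (induction G rule: finite_induct)
  case empty
  obtain e where e: "e \<in> E" "e \<noteq> 0"
    using Fbar_nonzero[OF E] by blast
  then have "lin_span D {e} \<in> fg D" "lin_span D {e} \<subseteq> E"
    using E fgI[of "{e}" e] lin_span_least[of D E "{e}"] by (simp_all add: Fbar_iff)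
  then show ?case by blast
next
  case (insert x G)
  then obtain F1 where F1: "F1 \<in> fg D" "F1 \<subseteq> E" "G \<subseteq> star F1" by auto
  obtain F2 where F2: "F2 \<in> fg D" "F2 \<subseteq> E" "x \<in> star F2"
    using insert.prems by (auto simp: star_f_iff)
  obtain F where F: "F \<in> fg D" "F1 \<subseteq> F" "F2 \<subseteq> F"
      "\<And>E. is_module D E \<Longrightarrow> F1 \<subseteq> E \<Longrightarrow> F2 \<subseteq> E \<Longrightarrow> F \<subseteq> E"
    using fg_join[OF F1(1) F2(1)] by metis
  have "F \<subseteq> E"
    using F(4) F1(2) F2(2) E by (simp add: Fbar_iff)
  moreover have "insert x G \<subseteq> star F"
    using star_fg_mono[OF F1(1) F(1,2)] star_fg_mono[OF F2(1) F(1,3)] F1(3) F2(3) by blast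
  ultimately show ?case
    using F(1) by blast
qed

lemma star_f_superset:
  assumes "E \<in> Fbar D"
  shows "E \<subseteq> star_f E"
proof
  fix x assume x: "x \<in> E"
  obtain e where e: "e \<in> E" "e \<noteq> 0"
    using Fbar_nonzero[OF assms] by blast
  let ?F = "lin_span D {x, e}"
  have F: "?F \<in> fg D"
    using e by (intro fgI[of _ e]) auto
  moreover have "?F \<subseteq> E"
    using assms e x by (intro lin_span_least) (auto simp: Fbar_iff)
  moreover have "x \<in> star ?F"
    using lin_span_superset[of "{x, e}"] star_superset[OF fg_Fbar[OF F]] by blast
  ultimately show "x \<in> star_f E"
    unfolding star_f_iff by blast
qed

lemma star_f_module:
  assumes E: "E \<in> Fbar D"
  shows "is_module D (star_f E)"
  unfolding is_module_def
proof (intro conjI ballI)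
  show "0 \<in> star_f E"
    using star_f_superset[OF E] E is_moduleD(1) by (auto simp: Fbar_iff)
next
  fix x y assume "x \<in> star_f E" "y \<in> star_f E"
  then obtain F where "F \<in> fg D" "F \<subseteq> E" "{x, y} \<subseteq> star F"
    using star_f_finite_cover[OF E, of "{x, y}"] by auto
  then show "x + y \<in> star_f E"
    unfolding star_f_iff using star_module is_moduleD(2) by (metis insert_subset)
next
  fix d x assume "d \<in> D" "x \<in> star_f E"
  then show "d * x \<in> star_f E"
    unfolding star_f_iff using star_module is_moduleD(3) by metis
qed

text \<open>Idempotence of \<open>star_f\<close>: the generators of a finitely generated
  \<open>F \<subseteq> J\<close> lie in a single \<open>star F'\<close>, and idempotence of
  \<open>star\<close> then gives \<open>star F \<subseteq> star F'\<close>.\<close>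

lemma star_f_absorb:
  assumes E: "E \<in> Fbar D" and "J \<subseteq> star_f E"
  shows "star_f J \<subseteq> star_f E"
proof
  fix x assume "x \<in> star_f J"
  then obtain F where F: "F \<in> fg D" "F \<subseteq> J" "x \<in> star F"
    by (auto simp: star_f_iff)
  obtain G where G: "finite G" "F = lin_span D G"
    using F(1) by (rule fgE)
  have "G \<subseteq> star_f E"
    using lin_span_superset[OF G(1)] G(2) F(2) assms(2) by blast
  then obtain F' where F': "F' \<in> fg D" "F' \<subseteq> E" "G \<subseteq> star F'"
    using star_f_finite_cover[OF E G(1)] by blast
  have "F \<subseteq> star F'"
    unfolding G(2) using star_module[OF F'(1)] F'(3) by (rule lin_span_least)
  then have "star F \<subseteq> star F'"
    using star_mono[of F "star F'"] star_idem[of F'] star_Fbar[of F'] F(1) F'(1) fg_Fbar by metis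
  then show "x \<in> star_f E"
    using F(3) F' by (auto simp: star_f_iff)
qed

lemma scale_module: "is_module D E \<Longrightarrow> is_module D ((*) x ` E)"
  unfolding is_module_def
  by (auto simp: image_iff mult.left_commute simp flip: distrib_left)

lemma lin_span_scale:
  assumes "finite G" "x \<noteq> 0"
  shows "(*) x ` lin_span D G = lin_span D ((*) x ` G)"
proof
  have sub: "lin_span D ((*) y ` H) \<subseteq> (*) y ` lin_span D H" if "finite H" for y H
    using that lin_span_superset
    by (intro lin_span_least scale_module lin_span_module image_mono)
  then show "lin_span D ((*) x ` G) \<subseteq> (*) x ` lin_span D G"
    using assms by blast
  \<comment> \<open>The inclusion just shown holds for every scalar; used with \<open>1/x\<close>
    and scaled back by \<open>x\<close>, it becomes the converse.\<close>
  have "lin_span D ((*) (1/x) ` (*) x ` G) \<subseteq> (*) (1/x) ` lin_span D ((*) x ` G)"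
    using sub assms by blast
  then have "lin_span D G \<subseteq> (*) (1/x) ` lin_span D ((*) x ` G)"
    using assms by (simp add: image_image)
  then have "(*) x ` lin_span D G \<subseteq> (*) x ` (*) (1/x) ` lin_span D ((*) x ` G)"
    by (rule image_mono)
  then show "(*) x ` lin_span D G \<subseteq> lin_span D ((*) x ` G)"
    using assms by (simp add: image_image)
qed

lemma fg_scale:
  assumes "F \<in> fg D" "x \<noteq> 0"
  shows "(*) x ` F \<in> fg D"
proof -
  obtain G g where G: "finite G" "F = lin_span D G" "g \<in> G" "g \<noteq> 0"
    using assms(1) by (rule fg_generator)
  then show ?thesis
    using assms(2) by (auto simp: lin_span_scale intro!: fgI[of _ "x * g"])
qed

lemma star_f_scale:
  assumes "x \<in> star_f E" "b \<noteq> 0"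
  shows "b * x \<in> star_f ((*) b ` E)"
proof -
  obtain F where F: "F \<in> fg D" "F \<subseteq> E" "x \<in> star F"
    using assms(1) by (auto simp: star_f_iff)
  then have "b * x \<in> star ((*) b ` F)"
    using star_scale[OF fg_Fbar assms(2)] by auto
  then show ?thesis
    unfolding star_f_iff using F fg_scale[OF _ assms(2)] by blast
qed

section \<open>Quasi-ideals and quasi-maximal ideals\<close>

lemma quasi_ideal_iff:
  "quasi_ideal D star_f I \<longleftrightarrow> is_module D I \<and> I \<subseteq> D \<and> I \<noteq> {0} \<and> star_f I \<inter> D \<subseteq> I"
  using star_f_superset[of I] by (auto simp: quasi_ideal_def ideal_iff Fbar_iff)

lemma quasi_ideal_closure:
  assumes "I \<in> Fbar D" "I \<subseteq> D"
  shows "quasi_ideal D star_f (star_f I \<inter> D)" "I \<subseteq> star_f I \<inter> D"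
proof -
  show sub: "I \<subseteq> star_f I \<inter> D"
    using star_f_superset[OF assms(1)] assms(2) by blast
  have "is_module D (star_f I \<inter> D)"
    using star_f_module[OF assms(1)] self_module by (auto simp: is_module_def)
  moreover have "star_f I \<inter> D \<noteq> {0}"
    using sub Fbar_nonzero[OF assms(1)] by blast
  moreover have "star_f (star_f I \<inter> D) \<subseteq> star_f I"
    using star_f_absorb[OF assms(1)] by blast
  ultimately show "quasi_ideal D star_f (star_f I \<inter> D)"
    by (auto simp: quasi_ideal_iff)
qed

lemma QMax_iff: "M \<in> QMax D star_f \<longleftrightarrow> quasi_ideal D star_f M \<and> 1 \<notin> M \<and>
    (\<forall>J. quasi_ideal D star_f J \<and> 1 \<notin> J \<and> M \<subseteq> J \<longrightarrow> J = M)"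
  unfolding QMax_def mem_Collect_eq using eq_carrier_iff quasi_ideal_iff by metis

text \<open>Let \<open>a * b \<in> Q\<close> with \<open>a \<notin> Q\<close>, and let
  \<open>I = Q + D a\<close>. Maximality forces 1 into \<open>star_f I\<close>; scaling by a nonzero
  \<open>b\<close> puts \<open>b\<close> into the closure of \<open>b I \<subseteq> Q\<close>, hence
  into \<open>Q\<close>.\<close>

lemma QMax_prime:
  assumes "Q \<in> QMax D star_f"
  shows "is_prime Q"
proof -
  have Q: "is_module D Q" "Q \<subseteq> D" "Q \<noteq> {0}" "star_f Q \<inter> D \<subseteq> Q" "1 \<notin> Q"
    using assms by (auto simp: QMax_iff quasi_ideal_iff)
  have "b \<in> Q" if ab: "a \<in> D" "b \<in> D" "a * b \<in> Q" and a: "a \<notin> Q" for a b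
  proof (cases "b = 0")
    case True
    then show ?thesis using is_moduleD(1)[OF Q(1)] by simp
  next
    case False
    define I where "I = {q + d * a |q d. q \<in> Q \<and> d \<in> D}"
    have I: "is_module D I"
      unfolding is_module_def
    proof (intro conjI ballI)
      show "0 \<in> I"
        unfolding I_def using is_moduleD(1)[OF Q(1)] by (auto intro!: exI[of _ 0])
    next
      fix x y assume "x \<in> I" "y \<in> I"
      then obtain p c q d where "x = p + c * a" "y = q + d * a" "p \<in> Q" "q \<in> Q" "c \<in> D" "d \<in> D"
        unfolding I_def by blast
      then show "x + y \<in> I"
        unfolding I_def using is_moduleD(2)[OF Q(1)] add_mem
        by (intro CollectI exI[of _ "p + q"] exI[of _ "c + d"]) (simp add: algebra_simps)
    next
      fix e x assume "e \<in> D" "x \<in> I"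
      then obtain p c where "x = p + c * a" "p \<in> Q" "c \<in> D"
        unfolding I_def by blast
      with \<open>e \<in> D\<close> show "e * x \<in> I"
        unfolding I_def using is_moduleD(3)[OF Q(1)] mult_mem
        by (intro CollectI exI[of _ "e * p"] exI[of _ "e * c"]) (simp add: algebra_simps)
    qed
    have ID: "I \<subseteq> D"
      unfolding I_def using Q(2) ab by (auto intro!: add_mem mult_mem)
    have QI: "Q \<subseteq> I"
    proof
      show "q \<in> I" if "q \<in> Q" for q
        unfolding I_def using that by (intro CollectI exI[of _ q] exI[of _ 0]) simp
    qed
    have aI: "a \<in> I"
      unfolding I_def using is_moduleD(1)[OF Q(1)] by (intro CollectI exI[of _ 0] exI[of _ 1]) simp
    have IF: "I \<in> Fbar D"
      using I QI aI a Q(1) is_moduleD(1) by (auto simp: Fbar_iff)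
    have "1 \<in> star_f I \<inter> D"
    proof (rule ccontr)
      assume "1 \<notin> star_f I \<inter> D"
      then have "star_f I \<inter> D = Q"
        using assms quasi_ideal_closure[OF IF ID] QI unfolding QMax_iff by blast
      with a aI quasi_ideal_closure(2)[OF IF ID] show False by blast
    qed
    then have "b * 1 \<in> star_f ((*) b ` I)"
      using False by (intro star_f_scale) auto
    moreover have "(*) b ` I \<subseteq> Q"
    proof -
      have "b * (q + d * a) \<in> Q" if "q \<in> Q" "d \<in> D" for q d
        using is_moduleD(2)[OF Q(1), of "b * q" "d * (a * b)"] is_moduleD(3)[OF Q(1) ab(2) that(1)]
          is_moduleD(3)[OF Q(1) that(2) ab(3)]
        by (simp add: algebra_simps)
      then show ?thesis
        unfolding I_def by blast
    qed
    ultimately show "b \<in> Q"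
      using star_f_mono[of "(*) b ` I" Q] Q(4) ab(2) by auto
  qed
  then show ?thesis
    unfolding is_prime_def using Q by blast
qed

lemma QSpec_iff: "P \<in> QSpec D star_f \<longleftrightarrow> is_prime P \<and> P \<noteq> {0} \<and> star_f P \<inter> D \<subseteq> P"
  by (auto simp: QSpec_def primeideal_iff quasi_ideal_iff is_prime_def)

lemma QMax_QSpec: "Q \<in> QMax D star_f \<Longrightarrow> Q \<in> QSpec D star_f"
  using QMax_prime[of Q] by (auto simp: QSpec_iff QMax_iff quasi_ideal_iff)

text \<open>Finite type is what makes this work: a finitely generated submodule of the union has its
  finitely many generators in one member of the chain.\<close>

lemma chain_Union_quasi_ideal:
  assumes "subset.chain {J. quasi_ideal D star_f J} C" "C \<noteq> {}"
  shows "quasi_ideal D star_f (\<Union>C)"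
proof -
  have C: "is_module D J" "J \<subseteq> D" "J \<noteq> {0}" "star_f J \<inter> D \<subseteq> J" if "J \<in> C" for J
    using assms(1) that by (auto simp: subset.chain_def quasi_ideal_iff)
  have "is_module D (\<Union>C)"
    unfolding is_module_def
  proof (intro conjI ballI)
    show "0 \<in> \<Union>C"
      using assms(2) C(1) is_moduleD(1) by blast
  next
    fix x y assume "x \<in> \<Union>C" "y \<in> \<Union>C"
    then obtain J where "J \<in> C" "{x, y} \<subseteq> J"
      using finite_subset_Union_chain[of "{x, y}" C] assms by auto
    then show "x + y \<in> \<Union>C"
      using is_moduleD(2)[OF C(1)] by auto
  next
    fix d x assume "d \<in> D" "x \<in> \<Union>C"
    then show "d * x \<in> \<Union>C"
      using is_moduleD(3)[OF C(1)] by auto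
  qed
  moreover have "\<Union>C \<noteq> {0}"
    using assms(2) C(1,3) is_moduleD(1) by blast
  moreover have "star_f (\<Union>C) \<inter> D \<subseteq> \<Union>C"
  proof
    fix x assume x: "x \<in> star_f (\<Union>C) \<inter> D"
    then obtain F where F: "F \<in> fg D" "F \<subseteq> \<Union>C" "x \<in> star F"
      by (auto simp: star_f_iff)
    obtain G where G: "finite G" "F = lin_span D G"
      using F(1) by (rule fgE)
    have "G \<subseteq> \<Union>C"
      using lin_span_superset[OF G(1)] G(2) F(2) by blast
    then obtain J where J: "J \<in> C" "G \<subseteq> J"
      using finite_subset_Union_chain[OF G(1) _ assms(2,1)] by blast
    then have "F \<subseteq> J"
      using lin_span_least[OF C(1)] G(2) by blast
    then have "x \<in> star_f J"
      using F by (auto simp: star_f_iff)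
    then show "x \<in> \<Union>C"
      using C(4)[OF J(1)] J(1) x by blast
  qed
  ultimately show ?thesis
    unfolding quasi_ideal_iff using C(2) by blast
qed

text \<open>Zorn's lemma; properness in the form \<open>1 \<notin> J\<close> passes to unions of
  chains.\<close>

lemma ex_QMax_superset:
  assumes "quasi_ideal D star_f I" "1 \<notin> I"
  shows "\<exists>Q\<in>QMax D star_f. I \<subseteq> Q"
proof -
  define A where "A = {J. quasi_ideal D star_f J \<and> 1 \<notin> J \<and> I \<subseteq> J}"
  have "\<exists>M\<in>A. \<forall>J\<in>A. M \<subseteq> J \<longrightarrow> J = M"
  proof (rule subset_Zorn_nonempty)
    show "A \<noteq> {}" using assms by (auto simp: A_def)
    show "\<Union>C \<in> A" if "C \<noteq> {}" "subset.chain A C" for C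
    proof -
      have "subset.chain {J. quasi_ideal D star_f J} C"
        using that(2) by (auto simp: A_def subset.chain_def)
      then have "quasi_ideal D star_f (\<Union>C)"
        using that(1) by (rule chain_Union_quasi_ideal)
      with that show ?thesis
        by (auto simp: A_def subset.chain_def)
    qed
  qed
  then obtain M where M: "M \<in> A" "\<And>J. J \<in> A \<Longrightarrow> M \<subseteq> J \<Longrightarrow> J = M"
    by blast
  have "J = M" if "quasi_ideal D star_f J" "1 \<notin> J" "M \<subseteq> J" for J
    using that M by (intro M(2)) (auto simp: A_def)
  then have "M \<in> QMax D star_f"
    using M(1) by (auto simp: QMax_iff A_def)
  then show ?thesis
    using M(1) by (auto simp: A_def)
qed

lemma QSpec_le_QMax: "P \<in> QSpec D star_f \<Longrightarrow> \<exists>Q\<in>QMax D star_f. P \<subseteq> Q"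
  using ex_QMax_superset by (auto simp: QSpec_def is_prime_def primeideal_iff)

section \<open>The overring as an intersection of localizations\<close>

abbreviation overring :: "'k set" where
  "overring \<equiv> tilde D star D"

lemma overring_iff: "x \<in> overring \<longleftrightarrow> (\<forall>Q\<in>QMax D star_f. x \<in> localization D Q)"
  by (simp add: tilde_def module_prod_localization QMax_prime)

lemma overring_le_localization: "P \<in> QSpec D star_f \<Longrightarrow> overring \<subseteq> localization D P"
  using QSpec_le_QMax[of P] localization_mono overring_iff by blast

lemma overring_superset: "D \<subseteq> overring"
  using overring_iff QMax_prime localization_superset by blast

sublocale over: field_domain overring
proof
  show "0 \<in> overring" "1 \<in> overring"
    using overring_superset zero_mem one_mem by blast+
  show "- x \<in> overring" if "x \<in> overring" for x
    using that QMax_prime localization_module module_uminus unfolding overring_iff by blast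
  show "x + y \<in> overring" "x * y \<in> overring" if "x \<in> overring" "y \<in> overring" for x y
    using that QMax_prime localization_add localization_mult unfolding overring_iff by blast+
  show "\<exists>a\<in>overring. \<exists>b\<in>overring - {0}. x = a / b" for x
    using is_fraction[of x] overring_superset by blast
qed

end

section \<open>Domains with invertible finitely generated modules\<close>

locale PstarMD_domain = semistar_domain +
  assumes PstarMD: "PstarMD D star"
begin

text \<open>The hypothesis \<open>PstarMD\<close> enters the argument here, through the element 1 of
  \<open>star D\<close>.\<close>

lemma one_mem_star_f_prod:
  assumes "F \<in> fg D"
  shows "1 \<in> star_f (module_prod F (colon D F))"
proof -
  have "D \<noteq> {0}"
    using one_mem by (metis singletonD zero_neq_one)
  then have "D \<in> Fbar D"
    by (simp add: Fbar_iff self_module)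
  then have "1 \<in> star D"
    using star_superset one_mem by blast
  then show ?thesis
    using PstarMD assms by (simp add: PstarMD_def)
qed

text \<open>Local form of invertibility: \<open>a * y\<close> lies in \<open>D - P\<close>, so it
  can serve as a denominator in \<open>localization D P\<close>.\<close>

lemma ex_generator_not_mem:
  assumes P: "P \<in> QSpec D star_f" and F: "lin_span D G \<in> fg D"
  obtains a y where "a \<in> G" "y \<in> colon D (lin_span D G)" "a * y \<notin> P"
proof (rule ccontr)
  assume "\<not> thesis"
  with that have *: "y * a \<in> P" if "a \<in> G" "y \<in> colon D (lin_span D G)" for a y
    using that by (metis mult.commute)
  have P': "is_module D P" "1 \<notin> P" "star_f P \<inter> D \<subseteq> P"
    using P by (auto simp: QSpec_iff is_prime_def)
  have "module_prod (lin_span D G) (colon D (lin_span D G)) \<subseteq> P"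
  proof (rule module_prod_least[OF P'(1)])
    fix x y assume xy: "x \<in> lin_span D G" "y \<in> colon D (lin_span D G)"
    then have "y \<in> colon P (lin_span D G)"
      using * by (intro colon_lin_spanI P') auto
    with xy show "x * y \<in> P"
      by (auto simp: colon_def mult.commute)
  qed
  then have "1 \<in> star_f P"
    using star_f_mono one_mem_star_f_prod[OF F] by blast
  with P'(2,3) one_mem show False by blast
qed

section \<open>Invertibility over the overring\<close>

lemma overring_module_imp: "is_module overring E \<Longrightarrow> is_module D E"
  using overring_superset by (auto simp: is_module_def)

text \<open>The same generators also span a finitely generated \<open>D\<close>-module, to which the
  invertibility hypothesis on \<open>D\<close> applies.\<close>

lemma overring_fgE:
  assumes "F \<in> fg overring"
  obtains G where "finite G" "F = lin_span overring G" "lin_span D G \<in> fg D" "G \<subseteq> F"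
    "lin_span D G \<subseteq> F"
proof -
  obtain G x where G: "finite G" "F = lin_span overring G" "x \<in> G" "x \<noteq> 0"
    using assms by (rule over.fg_generator)
  have "lin_span D G \<subseteq> F"
    using over.lin_span_superset[OF G(1)] over.lin_span_module G(2)
    by (metis lin_span_least overring_module_imp)
  with that[of G] over.lin_span_superset[OF G(1)] G fgI show thesis
    by blast
qed

lemma overring_t_prod:
  assumes "F \<in> fg overring"
  shows "t_op overring (module_prod F (colon overring F)) = overring"
proof
  let ?I = "module_prod F (colon overring F)"
  obtain G where G: "finite G" "F = lin_span overring G" "lin_span D G \<in> fg D" "G \<subseteq> F"
      "lin_span D G \<subseteq> F"
    using assms by (rule overring_fgE)
  let ?F = "lin_span D G"
  have F: "is_module overring F"
    by (simp add: G(2) over.lin_span_module)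
  have "?I \<subseteq> overring"
    by (rule over.module_prod_colon_subset)
  then show "t_op overring ?I \<subseteq> overring"
    by (rule over.t_op_subset_carrier)
  obtain J where J: "J \<in> fg D" "J \<subseteq> module_prod ?F (colon D ?F)" "1 \<in> star J"
    using one_mem_star_f_prod[OF G(3)] by (auto simp: star_f_iff)
  obtain S s where S: "finite S" "J = lin_span D S" "s \<in> S" "s \<noteq> 0"
    using J(1) by (rule fg_generator)
  let ?J = "lin_span overring S"
  have JD: "J \<subseteq> D"
    using J(2) module_prod_colon_subset by blast
  \<comment> \<open>Tested on the common generators \<open>G\<close>, an element of the
    \<open>D\<close>-inverse of \<open>?F\<close> also belongs to the inverse of \<open>F\<close>
    over \<open>overring\<close>.\<close>
  have "module_prod ?F (colon D ?F) \<subseteq> ?I"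
  proof (rule module_prod_least)
    show "is_module D ?I"
      using F by (intro overring_module_imp over.module_prod_module)
    fix x y assume xy: "x \<in> ?F" "y \<in> colon D ?F"
    have "y \<in> colon overring F"
      unfolding G(2)
    proof (rule over.colon_lin_spanI[OF over.self_module])
      show "y * g \<in> overring" if "g \<in> G" for g
        using that xy(2) lin_span_superset[OF G(1)] overring_superset by (auto simp: colon_def)
    qed
    with xy(1) G(5) show "x * y \<in> ?I"
      by (intro module_prodI) auto
  qed
  then have "?J \<subseteq> ?I"
    using F J(2) S(2) lin_span_superset[OF S(1)]
    by (intro lin_span_least over.module_prod_module) auto
  moreover have "?J \<in> fg overring"
    using S by (intro over.fgI)
  \<comment> \<open>Checked at each quasi-maximal \<open>Q\<close>: since
    \<open>1 \<in> star J\<close>, some \<open>j \<in> J\<close> avoids \<open>Q\<close>, and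
    \<open>b = b * j / j\<close> has a denominator outside \<open>Q\<close>.\<close>
  moreover have "colon overring ?J \<subseteq> overring"
  proof
    fix b assume b: "b \<in> colon overring ?J"
    have "b \<in> localization D Q" if Q: "Q \<in> QMax D star_f" for Q
    proof -
      have Q': "is_prime Q" "star_f Q \<inter> D \<subseteq> Q" "1 \<notin> Q"
        using QMax_QSpec[OF Q] by (auto simp: QSpec_iff is_prime_def)
      have "1 \<in> star_f Q" if "J \<subseteq> Q"
        using that J by (auto simp: star_f_iff)
      then have "\<not> J \<subseteq> Q"
        using Q'(2,3) one_mem by blast
      then obtain j where j: "j \<in> J" "j \<in> D - Q"
        using JD by blast
      have "J \<subseteq> ?J"
        unfolding S(2) using over.lin_span_superset[OF S(1)] over.lin_span_module
        by (intro lin_span_least overring_module_imp)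
      then have "b * j \<in> localization D Q"
        using b j(1) Q by (auto simp: colon_def overring_iff)
      then have "b * j / j \<in> localization D Q"
        using Q'(1) j(2) by (intro localization_divide)
      moreover have "j \<noteq> 0"
        using j(2) is_primeD(4)[OF Q'(1)] by auto
      ultimately show ?thesis by simp
    qed
    then show "b \<in> overring"
      by (simp add: overring_iff)
  qed
  \<comment> \<open>Every element of \<open>overring\<close> multiplies the inverse of
    \<open>?J\<close> back into \<open>overring\<close>; thus \<open>?J\<close> is the finitely
    generated witness for \<open>t_op\<close>.\<close>
  then have "overring \<subseteq> v_op overring ?J"
    using over.mult_mem by (auto simp: v_op_def colon_def)
  ultimately show "overring \<subseteq> t_op overring ?I"
    by (meson over.t_op_iff subsetD subsetI)
qed

lemma PvMD_overring: "PvMD overring"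
  using overring_t_prod over.field_domain_axioms
  by (auto simp: PvMD_def domain_with_quotient_field_iff)

section \<open>Correspondence between quasi-primes of \<open>D\<close> and t-primes of the
  overring\<close>

lemma QSpec_imp_tSpec:
  assumes "P \<in> QSpec D star_f"
  shows "prime_extension P \<inter> overring \<in> tSpec overring"
    and "prime_extension P \<inter> overring \<inter> D = P"
proof -
  let ?Q = "prime_extension P \<inter> overring"
  have P: "is_prime P" "P \<noteq> {0}"
    using assms by (auto simp: QSpec_iff)
  have loc: "overring \<subseteq> localization D P"
    using assms by (rule overring_le_localization)
  show int: "?Q \<inter> D = P"
    using prime_extension_Int[OF P(1)] overring_superset by blast
  have "over.is_prime ?Q"
    unfolding over.is_prime_def is_module_def
  proof (intro conjI ballI impI)
    show "0 \<in> ?Q" "1 \<notin> ?Q"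
      using int is_primeD(3,4)[OF P(1)] one_mem by blast+
    show "x + y \<in> ?Q" if "x \<in> ?Q" "y \<in> ?Q" for x y
      using that prime_extension_add[OF P(1)] over.add_mem by blast
    show "x * y \<in> ?Q" if "x \<in> overring" "y \<in> ?Q" for x y
      using that prime_extension_mult[OF P(1)] over.mult_mem loc by blast
    show "x \<in> ?Q \<or> y \<in> ?Q" if "x \<in> overring" "y \<in> overring" "x * y \<in> ?Q" for x y
      using that prime_extension_prime[OF P(1), of x y] loc by blast
  qed auto
  moreover have "?Q \<noteq> {0}"
    using int P(2) zero_mem by blast
  moreover have "t_op overring ?Q \<subseteq> ?Q"
  proof
    fix z assume "z \<in> t_op overring ?Q"
    then obtain F where F: "F \<in> fg overring" "F \<subseteq> ?Q" "z \<in> v_op overring F"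
      by (auto simp: over.t_op_iff)
    obtain G where G: "finite G" "F = lin_span overring G" "lin_span D G \<in> fg D" "G \<subseteq> F"
      using F(1) by (rule overring_fgE)
    obtain a y where ay: "a \<in> G" "y \<in> colon D (lin_span D G)" "a * y \<notin> P"
      using assms G(3) by (rule ex_generator_not_mem)
    have yG: "y * g \<in> D" if "g \<in> G" for g
      using that ay(2) lin_span_superset[OF G(1)] by (auto simp: colon_def)
    then have "y \<in> colon overring F"
      unfolding G(2) using overring_superset by (intro over.colon_lin_spanI over.self_module) auto
    then have "z * y \<in> localization D P"
      using F(3) loc by (auto simp: v_op_def colon_def)
    then have "z * y / (a * y) \<in> localization D P"
      using P(1) ay(3) yG[OF ay(1)] by (intro localization_divide) (auto simp: mult.commute)
    moreover have "a \<in> prime_extension P"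
      using ay(1) G(4) F(2) by blast
    \<comment> \<open>The product equals \<open>z\<close>, now displayed as a multiple, over the
      localization, of the generator \<open>a \<in> F \<subseteq> ?Q\<close>.\<close>
    ultimately have "z * y / (a * y) * a \<in> prime_extension P"
      using P(1) by (intro prime_extension_mult)
    moreover have "a * y \<noteq> 0"
      using ay(3) is_primeD(4)[OF P(1)] by auto
    ultimately have "z \<in> prime_extension P"
      by simp
    moreover have "z \<in> overring"
      using F over.v_op_subset_carrier[of F] by blast
    ultimately show "z \<in> ?Q" by blast
  qed
  ultimately show "?Q \<in> tSpec overring"
    by (simp add: over.tSpec_iff)
qed

lemma tSpec_imp_QSpec:
  assumes "Q \<in> tSpec overring"
  shows "Q \<inter> D \<in> QSpec D star_f"
proof -
  have Q: "over.is_prime Q" "Q \<noteq> {0}" "t_op overring Q \<subseteq> Q"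
    using assms by (auto simp: over.tSpec_iff)
  note Qm = over.is_primeD(1)[OF Q(1)]
  have "is_module D (Q \<inter> D)"
    using overring_module_imp[OF Qm] self_module by (auto simp: is_module_def)
  then have "is_prime (Q \<inter> D)"
    using over.is_primeD(3,5)[OF Q(1)] overring_superset unfolding is_prime_def by blast
  moreover have "Q \<inter> D \<noteq> {0}"
  proof -
    obtain q where q: "q \<in> Q" "q \<noteq> 0"
      using Q(2) is_moduleD(1)[OF Qm] by blast
    \<comment> \<open>Clearing the denominator of a nonzero \<open>q \<in> Q\<close> gives a nonzero
      element of the contraction.\<close>
    obtain b where b: "b \<in> D - {0}" "b * q \<in> D"
      using nonzero_mult_mem by blast
    then have "b * q \<in> Q \<inter> D"
      using is_moduleD(3)[OF Qm] q overring_superset by blast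
    moreover have "b * q \<noteq> 0"
      using b q by simp
    ultimately show ?thesis by blast
  qed
  moreover have "star_f (Q \<inter> D) \<inter> D \<subseteq> Q \<inter> D"
  proof
    fix x assume "x \<in> star_f (Q \<inter> D) \<inter> D"
    then obtain F where F: "F \<in> fg D" "F \<subseteq> Q \<inter> D" "x \<in> star F" and xD: "x \<in> D"
      by (auto simp: star_f_iff)
    obtain G g where G: "finite G" "F = lin_span D G" "g \<in> G" "g \<noteq> 0"
      using F(1) by (rule fg_generator)
    \<comment> \<open>\<open>?H\<close> is \<open>F + D x\<close>; an element \<open>u\<close> of
      its inverse carries both \<open>x\<close> and the generators of \<open>F\<close> into
      \<open>D\<close>.\<close>
    let ?F = "lin_span overring G" and ?H = "lin_span D (insert x G)"
    have GF: "G \<subseteq> F"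
      unfolding G(2) using G(1) by (rule lin_span_superset)
    have H: "?H \<in> fg D"
      using G by (intro fgI[of _ g]) auto
    have "x \<in> v_op overring ?F"
      unfolding v_op_def colon_def
    proof (intro CollectI ballI)
      fix y assume "y \<in> {y. \<forall>b\<in>?F. y * b \<in> overring}"
      then have y: "y * g \<in> overring" if "g \<in> G" for g
        using that over.lin_span_superset[OF G(1)] by blast
      have "x * y \<in> localization D M" if M: "M \<in> QMax D star_f" for M
      proof -
        have M': "is_prime M" "star_f M \<inter> D \<subseteq> M"
          using QMax_QSpec[OF M] by (auto simp: QSpec_iff)
        obtain a u where au: "a \<in> insert x G" "u \<in> colon D ?H" "a * u \<notin> M"
          using QMax_QSpec[OF M] H by (rule ex_generator_not_mem)
        have u: "u * h \<in> D" if "h \<in> insert x G" for h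
          using that au(2) lin_span_superset[of "insert x G"] G(1) by (auto simp: colon_def)
        have u0: "u \<noteq> 0"
          using au(3) is_primeD(4)[OF M'(1)] by auto
        \<comment> \<open>The generator \<open>a\<close> avoiding \<open>M\<close> might be
          \<open>x\<close> itself, but then one from \<open>G\<close> does too: otherwise
          \<open>u F \<subseteq> M\<close>, so \<open>u * x\<close> lies in
          \<open>star_f M \<inter> D\<close>, hence in \<open>M\<close>, and no generator of
          \<open>?H\<close> is left for \<open>a\<close>.\<close>
        obtain c where c: "c \<in> G" "u * c \<notin> M"
        proof (rule ccontr)
          assume "\<not> thesis"
          with that have uM: "u * h \<in> M" if "h \<in> G" for h
            using that by blast
          then have "u \<in> colon M F"
            unfolding G(2) using is_primeD(1)[OF M'(1)] by (intro colon_lin_spanI)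
          then have "(*) u ` F \<subseteq> M"
            by (auto simp: colon_def)
          moreover have "u * x \<in> star_f ((*) u ` F)"
            using F(1,3) u0 by (intro star_f_scale) (auto simp: star_f_iff)
          ultimately have "u * x \<in> star_f M"
            using star_f_mono by blast
          then have "u * x \<in> M"
            using M'(2) u[of x] by blast
          with uM au(1,3) show False
            by (auto simp: mult.commute)
        qed
        \<comment> \<open>The target is \<open>x * y = (u * x) * (y * c) / (u * c)\<close>, whose
          denominator lies in \<open>D - M\<close>.\<close>
        have "u * x \<in> localization D M"
          using u[of x] localization_superset[OF M'(1)] by blast
        moreover have "y * c \<in> localization D M"
          using y[OF c(1)] M by (simp add: overring_iff)
        ultimately have "(u * x) * (y * c) \<in> localization D M"
          by (rule localization_mult[OF M'(1)])
        then have "(u * x) * (y * c) / (u * c) \<in> localization D M"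
          using M'(1) c u[of c] by (intro localization_divide) auto
        moreover have "u * c \<noteq> 0"
          using c(2) is_primeD(4)[OF M'(1)] by auto
        ultimately show ?thesis by simp
      qed
      then show "x * y \<in> overring"
        by (simp add: overring_iff)
    qed
    moreover have "?F \<subseteq> Q"
      using Qm GF F(2) by (intro lin_span_least) auto
    moreover have "?F \<in> fg overring"
      using G by (intro over.fgI)
    ultimately have "x \<in> t_op overring Q"
      unfolding over.t_op_iff by blast
    with Q(3) xD show "x \<in> Q \<inter> D" by blast
  qed
  ultimately show ?thesis
    by (simp add: QSpec_iff)
qed

lemma localization_overring:
  assumes "Q \<in> tSpec overring"
  shows "localization overring Q = localization D (Q \<inter> D)"
proof
  show "localization D (Q \<inter> D) \<subseteq> localization overring Q"
    using overring_superset by (force simp: localization_iff over.localization_iff)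
  have Q: "over.is_prime Q"
    using assms by (simp add: over.tSpec_iff)
  have P: "Q \<inter> D \<in> QSpec D star_f"
    using assms by (rule tSpec_imp_QSpec)
  then have P': "is_prime (Q \<inter> D)"
    by (simp add: QSpec_iff)
  note loc = overring_le_localization[OF P]
  show "localization overring Q \<subseteq> localization D (Q \<inter> D)"
  proof
    fix x assume "x \<in> localization overring Q"
    then obtain r s where rs: "r \<in> overring" "s \<in> overring - Q" "x = r / s"
      by (auto simp: over.localization_iff)
    then have "s \<in> localization D (Q \<inter> D)"
      using loc by blast
    then obtain a b where ab: "a \<in> D" "b \<in> D - Q \<inter> D" "s = a / b"
      unfolding localization_iff by blast
    have b0: "b \<noteq> 0"
      using ab(2) is_primeD(4)[OF P'] by auto
    \<comment> \<open>Both \<open>s\<close> and \<open>b\<close> avoid the prime \<open>Q\<close>,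
      so the numerator \<open>a = s * b\<close> does as well; this makes
      \<open>x = r * b / a\<close> a fraction over \<open>D - Q\<close>.\<close>
    have "s * b \<notin> Q"
      using over.is_primeD(5)[OF Q, of s b] rs(2) ab(2) overring_superset by blast
    then have a: "a \<in> D - Q \<inter> D"
      using ab b0 by simp
    have "r * b / a \<in> localization D (Q \<inter> D)"
      using P' a loc rs(1) ab(2) localization_superset[OF P']
      by (intro localization_divide localization_mult) auto
    then show "x \<in> localization D (Q \<inter> D)"
      using rs(3) ab(3) by simp
  qed
qed

end

theorem lemma1p8:
  fixes D R :: "'k::field set" and star :: "'k set \<Rightarrow> 'k set"
  assumes "domain_with_quotient_field D"
    and "semistar D star"
    and "R = tilde D star D"
    and "PstarMD D star"
  shows "PvMD R \<and>
         QSpec D (finite_type D star) = {Q \<inter> D |Q. Q \<in> tSpec R} \<and>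
         (\<forall>Q\<in>tSpec R. localization R Q = localization D (Q \<inter> D))"
proof -
  interpret PstarMD_domain D star
    using assms by (simp add: PstarMD_domain_def semistar_domain_def semistar_domain_axioms_def
        PstarMD_domain_axioms_def domain_with_quotient_field_iff)
  have "P \<in> {Q \<inter> D |Q. Q \<in> tSpec overring}" if "P \<in> QSpec D star_f" for P
    using QSpec_imp_tSpec[OF that] by blast
  then show ?thesis
    unfolding assms(3) using PvMD_overring tSpec_imp_QSpec localization_overring by blast
qed

end
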